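(* Let $n\ge 2$ and let $\Omega\subset\mathbb{R}^n$ be a John domain. There exist positive constants $C$ and $C_1$, depending only on $n$ and $\Omega$, such that for every $s\in(0,1)$, every $1\le p<\infty$ and every $f\in C^\infty(\Omega)$ there is a constant $\bar f\in\mathbb{R}$ such that for all $y\in\Omega$ $$ |f(y)-\bar f|\le C\int_{|y-x|\le C_1 d(x)}\frac{h(x)}{|x-y|^{n-s}}\,dx, $$ where $$ h(x):=\left(\int_{|x-w|\le d(x)/2}\frac{|f(w)-f(x)|^p}{|w-x|^{n+sp}}\,dw\right)^{1/p}\quad\text{for } x\in\Omega, $$ and $h\equiv 0$ outside $\Omega$.
   Context: $d(x)=\mathrm{dist}(x,\partial\Omega)$ for $x\in\Omega$; since $h\equiv0$ outside $\Omega$, the integral in $x$ is over $x\in\Omega$ with $|y-x|\le C_1d(x)$. John domain: it is assumed that $0\in\Omega$. A bounded domain $\Omega\subset\mathbb{R}^n$ is a John domain if there exist a family of rectifiable curves $\gamma(t,y)$, $0\le t\le 1$, $y\in\Omega$, and positive constants $\lambda,K,C_0$ such that: (1) $\gamma(0,y)=y$ and $\gamma(1,y)=0$; (2) $d(\gamma(t,y))\ge\lambda t$; (3) $|\dot\gamma(t,y)|\le K$, where the dot denotes the derivative in $t$; (4) for all $x,y\in\Omega$ and $r\le\frac12 d(x)$, $\ell(\gamma(y)\cap B(x,r))\le C_0 r$, where $\gamma(y)$ denotes the curve $\gamma(\cdot,y)$ joining $y$ with $0$ and $\ell$ denotes length. *)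

theory Defs
  imports "HOL-Analysis.Analysis"
begin

definition bdist :: "'a::euclidean_space set \<Rightarrow> 'a \<Rightarrow> real" where
  "bdist \<Omega> x = infdist x (frontier \<Omega>)"

text \<open>Length of the part of the curve \<open>g : [0,1] \<rightarrow> \<real>\<^sup>n\<close> lying in \<open>U\<close>, counted with multiplicity:
  the supremum of the sums \<open>\<Sum> |g(b) - g(a)|\<close> over finite families of non-overlapping
  intervals \<open>[a,b] \<subseteq> [0,1]\<close> that \<open>g\<close> maps into \<open>U\<close>.  For \<open>U = UNIV\<close> this is the total variation,
  and for \<open>U\<close> open and \<open>g\<close> absolutely continuous it is the integral of \<open>|g'|\<close> over
  \<open>{t \<in> [0,1]. g t \<in> U}\<close>.\<close>

definition curve_length_in :: "(real \<Rightarrow> 'a::euclidean_space) \<Rightarrow> 'a set \<Rightarrow> ennreal" where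
  "curve_length_in g U =
     (SUP D \<in> {D. D division_of \<Union>D \<and> \<Union>D \<subseteq> {t\<in>{0..1}. g t \<in> U}}.
        \<Sum>k\<in>D. ennreal (norm (g (Sup k) - g (Inf k))))"

definition rectifiable_curve :: "(real \<Rightarrow> 'a::euclidean_space) \<Rightarrow> bool" where
  "rectifiable_curve g \<longleftrightarrow> continuous_on {0..1} g \<and> curve_length_in g UNIV < \<infinity>"

definition abs_continuous_curve :: "(real \<Rightarrow> 'a::euclidean_space) \<Rightarrow> bool" where
  "abs_continuous_curve g \<longleftrightarrow>
     (\<forall>\<epsilon>>0. \<exists>\<delta>>0. \<forall>D. D division_of \<Union>D \<and> \<Union>D \<subseteq> {0..1} \<and> (\<Sum>k\<in>D. Sup k - Inf k) < \<delta>
        \<longrightarrow> (\<Sum>k\<in>D. norm (g (Sup k) - g (Inf k))) < \<epsilon>)"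

text \<open>The curve joining \<open>y\<close> to \<open>0\<close> is \<open>\<gamma> y\<close>.  The derivative bound is required at almost every \<open>t\<close>,
  the curves being absolutely continuous; without absolute continuity such a bound would say
  nothing (think of curves parametrised by the Cantor function).  In particular curves that are
  differentiable at every \<open>t\<close> with derivative bounded by \<open>K\<close>, and piecewise smooth ones, are
  covered.\<close>

definition John_domain :: "'a::euclidean_space set \<Rightarrow> bool" where
  "John_domain \<Omega> \<longleftrightarrow>
     open \<Omega> \<and> connected \<Omega> \<and> bounded \<Omega> \<and> 0 \<in> \<Omega> \<and>
     (\<exists>(\<gamma> :: 'a \<Rightarrow> real \<Rightarrow> 'a) \<kappa> K C\<^sub>0. \<kappa> > 0 \<and> K > 0 \<and> C\<^sub>0 > 0 \<and>
        (\<forall>y\<in>\<Omega>. rectifiable_curve (\<gamma> y) \<and> abs_continuous_curve (\<gamma> y) \<and> \<gamma> y ` {0..1} \<subseteq> \<Omega> \<and>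
           \<gamma> y 0 = y \<and> \<gamma> y 1 = 0 \<and>
           (\<forall>t\<in>{0..1}. bdist \<Omega> (\<gamma> y t) \<ge> \<kappa> * t) \<and>
           (AE t in lborel. t \<in> {0..1} \<longrightarrow>
              (\<exists>v. (\<gamma> y has_vector_derivative v) (at t within {0..1}) \<and> norm v \<le> K))) \<and>
        (\<forall>x\<in>\<Omega>. \<forall>y\<in>\<Omega>. \<forall>r. 0 < r \<and> r \<le> bdist \<Omega> x / 2 \<longrightarrow>
           curve_length_in (\<gamma> y) (ball x r) \<le> ennreal (C\<^sub>0 * r)))"

text \<open>\<open>C\<^sup>k\<close> functions on an open set, by iterated partial derivatives.\<close>

fun Ck_on :: "nat \<Rightarrow> ('a::euclidean_space \<Rightarrow> real) \<Rightarrow> 'a set \<Rightarrow> bool" where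
  "Ck_on 0 f S \<longleftrightarrow> continuous_on S f"
| "Ck_on (Suc k) f S \<longleftrightarrow>
     (\<forall>x\<in>S. f differentiable (at x)) \<and>
     (\<forall>b\<in>Basis. Ck_on k (\<lambda>x. frechet_derivative f (at x) b) S)"

definition Cinf_on :: "('a::euclidean_space \<Rightarrow> real) \<Rightarrow> 'a set \<Rightarrow> bool" where
  "Cinf_on f S \<longleftrightarrow> (\<forall>k. Ck_on k f S)"

text \<open>Positive real powers on \<open>[0,\<infinity>]\<close>; only used for exponents \<open>a > 0\<close>.\<close>

definition ennreal_powr :: "ennreal \<Rightarrow> real \<Rightarrow> ennreal" where
  "ennreal_powr X a = (if X = \<infinity> then \<infinity> else ennreal (enn2real X powr a))"

text \<open>The integrands below have junk values at the single points \<open>w = x\<close> and \<open>x = y\<close>, which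
  do not affect the integrals.\<close>

definition hfun :: "'a::euclidean_space set \<Rightarrow> real \<Rightarrow> real \<Rightarrow> ('a \<Rightarrow> real) \<Rightarrow> 'a \<Rightarrow> ennreal" where
  "hfun \<Omega> s p f x =
     (if x \<in> \<Omega> then
        ennreal_powr
          (\<integral>\<^sup>+ w \<in> {w. norm (x - w) \<le> bdist \<Omega> x / 2}.
             ennreal (\<bar>f w - f x\<bar> powr p / norm (w - x) powr (real DIM('a) + s * p)) \<partial>lborel)
          (1 / p)
      else 0)"

end

theory Submission
  imports Defs
begin

text \<open>
  Join \<open>y\<close> to \<open>0\<close> by its John curve and let \<open>B k\<close> be the ball about \<open>\<gamma> y (q ^ k)\<close> of radius \<open>c q ^ k\<close>, with
  \<open>c\<close> small compared with \<open>\<kappa>\<close> and \<open>q < 1\<close> close to 1.  The first ball is centred at 0 and is the same for all \<open>y\<close>;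
  the mean of \<open>f\<close> over it is the constant \<open>fbar\<close>.  The balls shrink to \<open>y\<close>, so the means \<open>a k\<close>
  over them converge to \<open>f y\<close> by continuity (\<open>mean_cball_tendsto\<close>), and \<open>\<bar>f y - fbar\<bar>\<close> is at most the sum of the increments
  \<open>\<bar>a k - a (k + 1)\<bar>\<close>.

  An increment is at most the mean over \<open>x\<close> in \<open>B k\<close> of \<open>\<bar>f x - a (k + 1)\<bar>\<close>.  Because \<open>d(\<gamma> y t) \<ge> \<kappa> t\<close> and the curve is
  \<open>K\<close>-Lipschitz, \<open>B (k + 1)\<close> lies in the ball of radius \<open>d(x) / 2\<close> about each such \<open>x\<close>, and Jensen's inequality gives
  \<open>\<bar>f x - a (k + 1)\<bar> \<le> const (q ^ k)\<^sup>s h(x)\<close> (\<open>deviation_from_mean_le_hfun\<close>).  Hence an increment is at most a constant times the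
  integral of \<open>(q ^ k) powr (s - n) * h(x)\<close> over \<open>B k\<close>.

  It remains to sum over \<open>k\<close> under the integral.  A point \<open>x\<close> of \<open>B k\<close> satisfies \<open>\<bar>x - y\<bar> \<le> (K + c) q ^ k\<close>, so for fixed
  \<open>x\<close> only the scales \<open>q ^ k \<ge> \<bar>x - y\<bar> / (K + c)\<close> occur.  As \<open>n - s \<ge> 1\<close>, the sum of \<open>(q ^ k) powr (s - n)\<close> over these
  scales is a geometric sum dominated by its largest term, \<open>const \<bar>x - y\<bar> powr (s - n)\<close>
  (\<open>suminf_scales_le\<close>).  This produces the kernel, however many of the balls overlap at \<open>x\<close>.  All
  constants are kept uniform in \<open>s\<close> and \<open>p\<close>.

  The Lipschitz bound for the curves comes from absolute continuity and the almost everywhere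
  bound on the derivative (\<open>abs_continuous_curve_Lipschitz\<close>).
\<close>

section \<open>Curves with almost everywhere bounded derivative\<close>

text \<open>The mean value inequality for absolutely continuous curves.  Since the derivative is controlled only off
  a null set \<open>N\<close>, cover \<open>N\<close> by an open set \<open>T\<close> of small measure and choose a gauge that forces every
  interval tagged in \<open>N\<close> into \<open>T\<close>, and makes the derivative bound effective on every other interval.  In a
  fine tagged division of \<open>[a,b]\<close>, which exists by Cousin's lemma, the intervals tagged in \<open>N\<close> have small
  total length, so absolute continuity makes their contribution small; the remaining ones contribute at most
  \<open>K + \<epsilon>\<close> times their length.\<close>

lemma abs_continuous_curve_Lipschitz:
  fixes g :: "real \<Rightarrow> 'a::euclidean_space"
  assumes ac: "abs_continuous_curve g"
    and deriv: "AE t in lborel. t \<in> {0..1} \<longrightarrow>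
          (\<exists>v. (g has_vector_derivative v) (at t within {0..1}) \<and> norm v \<le> K)"
    and "0 \<le> K" "0 \<le> a" "a \<le> b" "b \<le> 1"
  shows "norm (g b - g a) \<le> K * (b - a)"
proof (rule field_le_epsilon)
  fix e :: real assume "e > 0"
  define \<epsilon> where "\<epsilon> = e / 2"
  have "\<epsilon> > 0" using \<open>e > 0\<close> by (simp add: \<epsilon>_def)
  obtain \<delta> where "\<delta> > 0" and \<delta>: "\<And>D. D division_of \<Union>D \<Longrightarrow> \<Union>D \<subseteq> {0..1} \<Longrightarrow>
      (\<Sum>k\<in>D. Sup k - Inf k) < \<delta> \<Longrightarrow> (\<Sum>k\<in>D. norm (g (Sup k) - g (Inf k))) < \<epsilon>"
    using ac \<open>\<epsilon> > 0\<close> unfolding abs_continuous_curve_def by meson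
  obtain N where N: "N \<in> null_sets lborel"
    and good: "\<And>t. t \<in> space lborel - N \<Longrightarrow> t \<in> {0..1} \<longrightarrow>
      (\<exists>v. (g has_vector_derivative v) (at t within {0..1}) \<and> norm v \<le> K)"
    by (rule AE_E3[OF deriv]) (rule that)
  have N_leb: "N \<in> null_sets lebesgue"
    using N by (rule null_sets_completionI)
  obtain T where T: "open T" "N \<subseteq> T" "T - N \<in> lmeasurable" "emeasure lebesgue (T - N) < ennreal \<delta>"
    using sets_lebesgue_outer_open[of N \<delta>] N_leb \<open>\<delta> > 0\<close> by (metis null_setsD2)
  have eT: "emeasure lebesgue T < ennreal \<delta>"
    using T N_leb by (metis emeasure_Diff_null_set borel_open sets_completionI_sets sets_lborel)
  have T_meas: "T \<in> lmeasurable"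
    using eT T(1) by (intro fmeasurableI) (auto intro: borel_open less_trans)
  have mT: "measure lebesgue T < \<delta>"
    using eT T_meas \<open>\<delta> > 0\<close> by (simp add: emeasure_eq_measure2 ennreal_less_iff)
  have "\<exists>r>0. t \<in> {0..1} - N \<longrightarrow>
          (\<forall>s\<in>{0..1}. \<bar>s - t\<bar> < r \<longrightarrow> norm (g s - g t) \<le> (K + \<epsilon>) * \<bar>s - t\<bar>)" for t
  proof (cases "t \<in> {0..1} - N")
    case True
    then obtain v where v: "(g has_vector_derivative v) (at t within {0..1})" "norm v \<le> K"
      using good[of t] by auto
    then obtain r where "r > 0"
      and r: "\<And>s. s \<in> {0..1} \<Longrightarrow> norm (s - t) < r \<Longrightarrow>
                norm (g s - g t - (s - t) *\<^sub>R v) \<le> \<epsilon> * norm (s - t)"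
      using \<open>\<epsilon> > 0\<close> unfolding has_vector_derivative_def has_derivative_within_alt by blast
    have "norm (g s - g t) \<le> (K + \<epsilon>) * \<bar>s - t\<bar>" if "s \<in> {0..1}" "\<bar>s - t\<bar> < r" for s
    proof -
      have "norm (g s - g t) \<le> norm (g s - g t - (s - t) *\<^sub>R v) + norm ((s - t) *\<^sub>R v)"
        using norm_triangle_ineq[of "g s - g t - (s - t) *\<^sub>R v" "(s - t) *\<^sub>R v"] by simp
      also have "\<dots> \<le> \<epsilon> * \<bar>s - t\<bar> + \<bar>s - t\<bar> * K"
        using r[OF that(1)] that(2) v(2) by (intro add_mono) (auto intro: mult_left_mono)
      finally show ?thesis by (simp add: algebra_simps)
    qed
    then show ?thesis using \<open>r > 0\<close> by blast
  qed (auto intro: zero_less_one)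
  then obtain r where r_pos: "\<And>t. r t > 0"
    and r: "\<And>t s. t \<in> {0..1} - N \<Longrightarrow> s \<in> {0..1} \<Longrightarrow> \<bar>s - t\<bar> < r t \<Longrightarrow>
              norm (g s - g t) \<le> (K + \<epsilon>) * \<bar>s - t\<bar>"
    by metis
  define G where "G t = (if t \<in> N then T else ball t (r t))" for t
  have "gauge G"
    using T r_pos by (auto simp: gauge_def G_def)
  then obtain p where p: "p tagged_division_of {a..b}" "G fine p"
    using fine_division_exists_real by blast
  have piece: "\<exists>u v. k = {u..v} \<and> u \<le> t \<and> t \<le> v \<and> a \<le> u \<and> v \<le> b \<and> {u..v} \<subseteq> G t"
    if tk: "(t, k) \<in> p" for t k
  proof -
    obtain u v where "k = {u..v}" using tagged_division_ofD(4)[OF p(1) tk] by auto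
    then show ?thesis
      using tagged_division_ofD(2,3)[OF p(1) tk] p(2) tk by (force simp: fine_def)
  qed
  have fin: "finite p" using p(1) by blast
  define q where "q = {(t, k) \<in> p. t \<in> N}"
  have "q \<subseteq> p" by (auto simp: q_def)
  have q: "q tagged_partial_division_of {a..b}"
    using p(1) \<open>q \<subseteq> p\<close> by (metis tagged_division_of_def tagged_partial_division_subset)
  define D where "D = snd ` q"
  have D: "D division_of \<Union>D"
    using partial_division_of_tagged_division[OF q] by (simp add: D_def)
  have D_sub: "k \<subseteq> T \<and> k \<subseteq> {0..1} \<and> measure lebesgue k = Sup k - Inf k" if "k \<in> D" for k
  proof -
    obtain t where "(t, k) \<in> p" "t \<in> N" using \<open>k \<in> D\<close> by (auto simp: D_def q_def)
    then show ?thesis using piece[of t k] assms by (auto simp: G_def)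
  qed
  have "(\<Sum>k\<in>D. Sup k - Inf k) = (\<Sum>k\<in>D. measure lebesgue k)"
    using D_sub by simp
  also have "\<dots> = measure lebesgue (\<Union>D)"
    by (rule content_division[OF D])
  also have "\<dots> \<le> measure lebesgue T"
    using D_sub lmeasurable_division[OF D] T_meas by (intro measure_mono_fmeasurable) auto
  finally have "(\<Sum>k\<in>D. Sup k - Inf k) < \<delta>" using mT by simp
  then have bad: "(\<Sum>k\<in>D. norm (g (Sup k) - g (Inf k))) < \<epsilon>"
    using D D_sub by (intro \<delta>) auto
  \<comment> \<open>The sum over tagged intervals is turned into a sum over the family \<open>D\<close> itself.  Different tags may
    share a degenerate interval, on which the increment vanishes; the empty set gets the value 0
    because \<open>Sup {}\<close> and \<open>Inf {}\<close> are unspecified reals.\<close>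
  define d where "d k = (if k = {} then 0 else norm (g (Sup k) - g (Inf k)))" for k
  have "(\<Sum>(t, k)\<in>q. norm (g (Sup k) - g (Inf k))) = (\<Sum>(t, k)\<in>q. d k)"
    using piece \<open>q \<subseteq> p\<close> by (intro sum.cong) (fastforce simp: d_def)+
  also have "\<dots> = (\<Sum>k\<in>D. d k)"
    unfolding D_def
  proof (rule sum.over_tagged_division_lemma[OF tagged_partial_division_of_Union_self[OF q]])
    fix u v :: real assume "box u v = {}"
    then show "d (cbox u v) = 0"
      by (cases u v rule: linorder_cases) (auto simp: d_def)
  qed
  also have "\<dots> = (\<Sum>k\<in>D. norm (g (Sup k) - g (Inf k)))"
    using division_ofD(3)[OF D] by (intro sum.cong) (auto simp: d_def)
  finally have "(\<Sum>(t, k)\<in>q. norm (g (Sup k) - g (Inf k))) = (\<Sum>k\<in>D. norm (g (Sup k) - g (Inf k)))" .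
  with bad have q_sum: "(\<Sum>(t, k)\<in>q. norm (g (Sup k) - g (Inf k))) < \<epsilon>" by simp
  have "(\<Sum>(t, k)\<in>p - q. norm (g (Sup k) - g (Inf k))) \<le> (\<Sum>(t, k)\<in>p - q. (K + \<epsilon>) * (Sup k - Inf k))"
  proof (rule sum_mono, clarify)
    fix t k assume tk: "(t, k) \<in> p" "(t, k) \<notin> q"
    then obtain u v where uv: "k = {u..v}" "u \<le> t" "t \<le> v" "a \<le> u" "v \<le> b" "{u..v} \<subseteq> ball t (r t)"
      using piece[OF tk(1)] by (auto simp: q_def G_def)
    have "u \<in> {u..v}" "v \<in> {u..v}" using uv by auto
    then have "u \<in> ball t (r t)" "v \<in> ball t (r t)" using uv(6) by blast+
    then have uv01: "t \<in> {0..1} - N" "u \<in> {0..1}" "v \<in> {0..1}" "\<bar>u - t\<bar> < r t" "\<bar>v - t\<bar> < r t"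
      using uv tk assms by (auto simp: q_def dist_real_def abs_minus_commute)
    have "norm (g v - g u) \<le> norm (g v - g t) + norm (g u - g t)"
      using norm_triangle_ineq4[of "g v - g t" "g u - g t"] by simp
    also have "\<dots> \<le> (K + \<epsilon>) * \<bar>v - t\<bar> + (K + \<epsilon>) * \<bar>u - t\<bar>"
      using uv01 by (intro add_mono r) auto
    also have "\<dots> = (K + \<epsilon>) * (v - u)" using uv by (simp add: algebra_simps)
    finally show "norm (g (Sup k) - g (Inf k)) \<le> (K + \<epsilon>) * (Sup k - Inf k)"
      using uv by simp
  qed
  also have "\<dots> \<le> (\<Sum>(t, k)\<in>p. (K + \<epsilon>) * (Sup k - Inf k))"
    using fin \<open>0 \<le> K\<close> \<open>\<epsilon> > 0\<close> by (intro sum_mono2) (auto dest!: piece)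
  also have "\<dots> = (K + \<epsilon>) * (\<Sum>(t, k)\<in>p. Sup k - Inf k)"
    by (simp add: sum_distrib_left case_prod_unfold)
  also have "(\<Sum>(t, k)\<in>p. Sup k - Inf k) = b - a"
    using additive_tagged_division_1[OF \<open>a \<le> b\<close> p(1), of "\<lambda>x. x"] by simp
  finally have good_sum: "(\<Sum>(t, k)\<in>p - q. norm (g (Sup k) - g (Inf k))) \<le> (K + \<epsilon>) * (b - a)" .
  have "norm (g b - g a) = norm (\<Sum>(t, k)\<in>p. g (Sup k) - g (Inf k))"
    using additive_tagged_division_1[OF \<open>a \<le> b\<close> p(1), of g] by simp
  also have "\<dots> \<le> (\<Sum>(t, k)\<in>p. norm (g (Sup k) - g (Inf k)))"
    by (rule order_trans[OF norm_sum]) (simp add: case_prod_unfold)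
  also have "\<dots> = (\<Sum>(t, k)\<in>p - q. norm (g (Sup k) - g (Inf k))) +
                   (\<Sum>(t, k)\<in>q. norm (g (Sup k) - g (Inf k)))"
    using fin \<open>q \<subseteq> p\<close> by (rule sum.subset_diff[rotated])
  also have "\<dots> \<le> (K + \<epsilon>) * (b - a) + \<epsilon>"
    using good_sum q_sum by linarith
  also have "\<dots> = K * (b - a) + \<epsilon> * (b - a) + \<epsilon>"
    by (simp add: algebra_simps)
  also have "\<dots> \<le> K * (b - a) + \<epsilon> * 1 + \<epsilon>"
    using assms \<open>\<epsilon> > 0\<close> by (intro add_mono mult_left_mono) auto
  also have "\<dots> = K * (b - a) + e" by (simp add: \<epsilon>_def)
  finally show "norm (g b - g a) \<le> K * (b - a) + e" .
qed

section \<open>The distance to the boundary\<close>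

lemma ball_bdist_subset:
  assumes "x \<in> \<Omega>"
  shows "ball x (bdist \<Omega> x) \<subseteq> \<Omega>"
proof (cases "bdist \<Omega> x > 0")
  case True
  show ?thesis
  proof (rule ccontr)
    assume "\<not> ?thesis"
    moreover have "x \<in> ball x (bdist \<Omega> x) \<inter> \<Omega>" using True assms by simp
    ultimately obtain z where "z \<in> ball x (bdist \<Omega> x)" "z \<in> frontier \<Omega>"
      using connected_Int_frontier[of "ball x (bdist \<Omega> x)" \<Omega>] by blast
    then show False
      using infdist_le[of z "frontier \<Omega>" x] by (simp add: bdist_def)
  qed
next
  case False
  then have "ball x (bdist \<Omega> x) = {}" by (simp add: ball_eq_empty)
  then show ?thesis by blast
qed

lemma bdist_triangle: "bdist \<Omega> x \<le> bdist \<Omega> y + dist x y"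
  unfolding bdist_def by (rule infdist_triangle)

section \<open>Mean values over compact sets\<close>

definition mean :: "'a::euclidean_space set \<Rightarrow> ('a \<Rightarrow> real) \<Rightarrow> real" where
  "mean B u = (LINT w:B|lborel. u w) / measure lborel B"

lemma continuous_on_compact_set_integrable:
  fixes u :: "'a::euclidean_space \<Rightarrow> real"
  assumes "compact B" "continuous_on B u"
  shows "set_integrable lborel B u"
  using borel_integrable_compact[OF assms] by (simp add: set_integrable_def)

context
  fixes B :: "'a::euclidean_space set"
  assumes B: "compact B" "measure lborel B > 0"
begin

lemma mean_const: "mean B (\<lambda>_. c) = c"
proof -
  have "(LINT w:B|lborel. c) = measure lborel B * c"
    using emeasure_compact_finite[OF B(1)] B(1)
    by (subst set_integral_const) (auto simp: borel_compact)
  then show ?thesis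
    using B(2) by (simp add: mean_def)
qed

lemma mean_mono:
  assumes "continuous_on B u" "continuous_on B v" "\<And>w. w \<in> B \<Longrightarrow> u w \<le> v w"
  shows "mean B u \<le> mean B v"
  unfolding mean_def using assms B
  by (intro divide_right_mono set_integral_mono continuous_on_compact_set_integrable) auto

lemma mean_add:
  assumes "continuous_on B u" "continuous_on B v"
  shows "mean B (\<lambda>w. u w + v w) = mean B u + mean B v"
  unfolding mean_def using assms B
  by (simp add: set_integral_add(2) continuous_on_compact_set_integrable add_divide_distrib)

lemma mean_cmult: "mean B (\<lambda>w. c * u w) = c * mean B u"
  by (simp add: mean_def)

lemma mean_diff_const:
  assumes "continuous_on B u"
  shows "mean B (\<lambda>w. u w - c) = mean B u - c"
  using mean_add[of u "\<lambda>_. - c"] mean_const[of "- c"] assms by simp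

lemma abs_mean_le:
  assumes "continuous_on B u"
  shows "\<bar>mean B u\<bar> \<le> mean B (\<lambda>w. \<bar>u w\<bar>)"
  using assms mean_mono[of u "\<lambda>w. \<bar>u w\<bar>"] mean_mono[of "\<lambda>w. - 1 * u w" "\<lambda>w. \<bar>u w\<bar>"]
  unfolding mean_cmult by (force intro: continuous_intros)

text \<open>Jensen's inequality for \<open>x \<mapsto> x powr p\<close>: integrate the tangent line of this convex function at the point
  \<open>m = mean B u\<close>.\<close>

lemma mean_powr_le:
  assumes u: "continuous_on B u" "\<And>w. w \<in> B \<Longrightarrow> u w \<ge> 0" and "p \<ge> 1"
  shows "mean B u powr p \<le> mean B (\<lambda>w. u w powr p)"
proof -
  define m where "m = mean B u"
  have cp: "continuous_on B (\<lambda>w. u w powr p)"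
    using u \<open>p \<ge> 1\<close> by (intro continuous_on_powr') auto
  have "m \<ge> 0"
    using mean_mono[of "\<lambda>_. 0" u] u by (simp add: m_def mean_const)
  show ?thesis
  proof (cases "m = 0")
    case True
    then show ?thesis
      using mean_mono[of "\<lambda>_. 0" "\<lambda>w. u w powr p"] cp by (simp add: m_def[symmetric] mean_const)
  next
    case False
    with \<open>m \<ge> 0\<close> have "m > 0" by simp
    have tangent: "m powr p + p * m powr (p - 1) * (x - m) \<le> x powr p" if "x \<ge> 0" for x
    proof (cases "x = 0")
      case True
      have "m powr p = m powr (p - 1) * m"
        using \<open>m > 0\<close> by (simp add: powr_diff)
      then have "m powr p + p * m powr (p - 1) * (x - m) = m powr p * (1 - p)"
        using True by (simp add: algebra_simps)
      also have "\<dots> \<le> 0" using \<open>p \<ge> 1\<close> by (simp add: mult_nonneg_nonpos)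
      finally show ?thesis using True by simp
    next
      case False
      have "p * m powr (p - 1) * (x - m) \<le> x powr p - m powr p"
        using \<open>m > 0\<close> \<open>x \<ge> 0\<close> False \<open>p \<ge> 1\<close>
        by (intro convex_on_imp_above_tangent[OF powr_convex[OF \<open>p \<ge> 1\<close>]])
           (auto intro!: derivative_eq_intros simp: interior_open powr_diff)
      then show ?thesis by simp
    qed
    define c where "c = p * m powr (p - 1)"
    have "mean B (\<lambda>w. m powr p + c * (u w - m)) \<le> mean B (\<lambda>w. u w powr p)"
      using u tangent by (intro mean_mono cp continuous_on_add continuous_on_mult continuous_on_diff continuous_on_const) (auto simp: c_def)
    moreover have "mean B (\<lambda>w. m powr p + c * (u w - m)) = m powr p"
      using u(1) by (subst mean_add) (auto intro!: continuous_intros simp: mean_const mean_cmult mean_diff_const m_def)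
    ultimately show ?thesis by (simp add: m_def)
  qed
qed

lemma ennreal_mean_eq:
  assumes "continuous_on B u" "\<And>w. w \<in> B \<Longrightarrow> u w \<ge> 0"
  shows "ennreal (mean B u) = (\<integral>\<^sup>+ w\<in>B. ennreal (u w / measure lborel B) \<partial>lborel)"
proof -
  define v where "v w = u w / measure lborel B" for w
  have "integrable lborel (\<lambda>w. indicator B w *\<^sub>R v w)"
    using assms(1) B by (intro borel_integrable_compact) (auto simp: v_def intro!: continuous_intros)
  then have "(\<integral>\<^sup>+ w. ennreal (indicator B w *\<^sub>R v w) \<partial>lborel) = ennreal (LINT w:B|lborel. v w)"
    unfolding set_lebesgue_integral_def using assms(2) B
    by (intro nn_integral_eq_integral) (auto simp: v_def indicator_def)
  moreover have "(LINT w:B|lborel. v w) = mean B u" by (simp add: mean_def v_def)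
  moreover have "(\<integral>\<^sup>+ w. ennreal (indicator B w *\<^sub>R v w) \<partial>lborel) = (\<integral>\<^sup>+ w\<in>B. ennreal (v w) \<partial>lborel)"
    by (intro nn_integral_cong) (auto simp: indicator_def)
  ultimately show ?thesis by (simp add: v_def)
qed

end

text \<open>Averages of a continuous function over balls shrinking to \<open>y\<close> converge to the value at \<open>y\<close>, even though
  the balls need not contain \<open>y\<close>.\<close>

lemma mean_cball_tendsto:
  fixes f :: "'a::euclidean_space \<Rightarrow> real"
  assumes "open \<Omega>" "y \<in> \<Omega>" "continuous_on \<Omega> f"
    and "z \<longlonglongrightarrow> y" "r \<longlonglongrightarrow> 0" "\<And>k. 0 < r k" "\<And>k. cball (z k) (r k) \<subseteq> \<Omega>"
  shows "(\<lambda>k. mean (cball (z k) (r k)) f) \<longlonglongrightarrow> f y"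
proof (rule LIMSEQ_I)
  fix e :: real assume "e > 0"
  obtain d where "d > 0" and d: "\<And>w. w \<in> \<Omega> \<Longrightarrow> dist w y < d \<Longrightarrow> dist (f w) (f y) < e / 2"
    using assms(2,3) \<open>e > 0\<close> unfolding continuous_on_iff by (metis half_gt_zero)
  have "(\<lambda>k. dist (z k) y + r k) \<longlonglongrightarrow> 0"
    using tendsto_add[OF tendsto_dist[OF assms(4) tendsto_const[of y]] assms(5)] by simp
  then obtain N where N: "\<And>k. k \<ge> N \<Longrightarrow> dist (z k) y + r k < d"
    using \<open>d > 0\<close> order_tendstoD(2)[of _ 0 sequentially d] unfolding eventually_sequentially by blast
  have "norm (mean (cball (z k) (r k)) f - f y) < e" if "k \<ge> N" for k
  proof -
    have B: "compact (cball (z k) (r k))" "measure lborel (cball (z k) (r k)) > 0"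
      using assms(6)[of k] by (auto simp: content_cball)
    have fk: "continuous_on (cball (z k) (r k)) f"
      using assms(3,7) continuous_on_subset by blast
    have "\<bar>mean (cball (z k) (r k)) f - f y\<bar> \<le> mean (cball (z k) (r k)) (\<lambda>w. \<bar>f w - f y\<bar>)"
      using abs_mean_le[OF B continuous_on_diff[OF fk continuous_on_const]]
      by (simp add: mean_diff_const[OF B fk])
    also have "\<dots> \<le> mean (cball (z k) (r k)) (\<lambda>_. e / 2)"
    proof (intro mean_mono[OF B])
      fix w assume w: "w \<in> cball (z k) (r k)"
      then have "dist w y < d"
        using N[OF that] dist_triangle[of w y "z k"] by (simp add: dist_commute)
      then show "\<bar>f w - f y\<bar> \<le> e / 2"
        using d[of w] w assms(7)[of k] by (auto simp: dist_real_def intro: less_imp_le)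
    qed (auto intro!: continuous_intros fk)
    also have "\<dots> < e" using mean_const[OF B] \<open>e > 0\<close> by simp
    finally show ?thesis by simp
  qed
  then show "\<exists>N. \<forall>k\<ge>N. norm (mean (cball (z k) (r k)) f - f y) < e" by blast
qed

section \<open>Telescoping and geometric sums\<close>

lemma abs_diff_limit_le_suminf:
  fixes a :: "nat \<Rightarrow> real"
  assumes "a \<longlonglongrightarrow> L"
  shows "ennreal \<bar>L - a 0\<bar> \<le> (\<Sum>k. ennreal \<bar>a k - a (Suc k)\<bar>)"
proof (rule LIMSEQ_le_const2)
  show "(\<lambda>m. ennreal \<bar>a m - a 0\<bar>) \<longlonglongrightarrow> ennreal \<bar>L - a 0\<bar>"
    by (intro tendsto_intros tendsto_ennrealI assms)
  have "ennreal \<bar>a m - a 0\<bar> \<le> (\<Sum>k. ennreal \<bar>a k - a (Suc k)\<bar>)" for m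
  proof -
    have "\<bar>a m - a 0\<bar> = \<bar>\<Sum>k<m. a k - a (Suc k)\<bar>"
      by (simp add: sum_lessThan_telescope' abs_minus_commute)
    also have "\<dots> \<le> (\<Sum>k<m. \<bar>a k - a (Suc k)\<bar>)"
      by (rule sum_abs)
    finally have "ennreal \<bar>a m - a 0\<bar> \<le> (\<Sum>k<m. ennreal \<bar>a k - a (Suc k)\<bar>)"
      by (simp add: ennreal_leI)
    also have "\<dots> \<le> (\<Sum>k. ennreal \<bar>a k - a (Suc k)\<bar>)"
      by (rule sum_le_suminf) auto
    finally show ?thesis .
  qed
  then show "\<exists>N. \<forall>m\<ge>N. ennreal \<bar>a m - a 0\<bar> \<le> (\<Sum>k. ennreal \<bar>a k - a (Suc k)\<bar>)"
    by blast
qed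

lemma sum_inverse_powers_le:
  fixes q :: real
  assumes "0 < q" "q < 1"
  shows "(\<Sum>k\<le>m. 1 / q ^ k) \<le> 1 / (q ^ m * (1 - q))"
proof (induction m)
  case 0
  then show ?case using assms by (simp add: field_simps)
next
  case (Suc m)
  have "(\<Sum>k\<le>Suc m. 1 / q ^ k) \<le> 1 / (q ^ m * (1 - q)) + 1 / q ^ Suc m"
    using Suc by simp
  also have "\<dots> = 1 / (q ^ Suc m * (1 - q))"
    using assms by (simp add: divide_simps)
  finally show ?case .
qed

text \<open>The summands \<open>a / q ^ k\<close> increase geometrically up to the largest index with \<open>a \<le> q ^ k\<close>, where they are at
  most 1; hence the last one dominates and the bound depends neither on \<open>a\<close> nor on \<open>m\<close>.\<close>

lemma sum_truncated_geometric_le: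
  fixes q a :: real
  assumes "0 < q" "q < 1" "0 < a"
  shows "(\<Sum>k<m. if a \<le> q ^ k then a / q ^ k else 0) \<le> 1 / (1 - q)"
proof (induction m)
  case 0
  then show ?case using assms by simp
next
  case (Suc m)
  show ?case
  proof (cases "a \<le> q ^ m")
    case True
    have "(\<Sum>k<Suc m. if a \<le> q ^ k then a / q ^ k else 0) \<le> (\<Sum>k<Suc m. a * (1 / q ^ k))"
      using assms by (intro sum_mono) auto
    also have "\<dots> = a * (\<Sum>k\<le>m. 1 / q ^ k)"
      by (simp add: sum_distrib_left lessThan_Suc_atMost)
    also have "\<dots> \<le> q ^ m * (1 / (q ^ m * (1 - q)))"
      using assms True by (intro mult_mono sum_inverse_powers_le sum_nonneg) auto
    also have "\<dots> = 1 / (1 - q)" using assms by simp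
    finally show ?thesis .
  next
    case False
    then show ?thesis using Suc by simp
  qed
qed

text \<open>In the application \<open>d = \<bar>x - y\<bar>\<close> and \<open>q ^ k\<close> runs through the scales at which the ball of radius
  \<open>b * q ^ k\<close> about \<open>y\<close> still reaches \<open>x\<close>.  With \<open>a = d / b\<close>, each term is \<open>a powr (- \<sigma>)\<close> times
  \<open>(a / q ^ k) powr \<sigma>\<close>, and the last factor is at most \<open>a / q ^ k\<close> because its base is at most 1 and
  \<open>\<sigma> \<ge> 1\<close>.  Reducing to the exponent 1 makes the factor \<open>1 / (1 - q)\<close> independent of \<open>\<sigma>\<close>, hence
  of \<open>s\<close>.\<close>

lemma suminf_scales_le:
  fixes q b d \<sigma> :: real
  assumes "0 < q" "q < 1" "0 < b" "0 < d" "1 \<le> \<sigma>"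
  shows "(\<Sum>k. ennreal (if d \<le> b * q ^ k then (q ^ k) powr (- \<sigma>) else 0))
           \<le> ennreal (b powr \<sigma> / (1 - q) * d powr (- \<sigma>))"
proof (rule suminf_le_const[OF summableI])
  fix m
  define a where "a = d / b"
  have "a > 0" using assms by (simp add: a_def)
  have "(\<Sum>k<m. if d \<le> b * q ^ k then (q ^ k) powr (- \<sigma>) else 0)
      \<le> (\<Sum>k<m. a powr (- \<sigma>) * (if a \<le> q ^ k then a / q ^ k else 0))"
  proof (rule sum_mono)
    fix k
    have iff: "d \<le> b * q ^ k \<longleftrightarrow> a \<le> q ^ k"
      using assms by (simp add: a_def field_simps)
    have "(q ^ k) powr (- \<sigma>) \<le> a powr (- \<sigma>) * (a / q ^ k)" if "a \<le> q ^ k"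
    proof -
      have "(q ^ k) powr (- \<sigma>) = a powr (- \<sigma>) * (a / q ^ k) powr \<sigma>"
        using assms \<open>a > 0\<close> by (simp add: powr_divide powr_minus field_simps)
      also have "(a / q ^ k) powr \<sigma> \<le> (a / q ^ k) powr 1"
        using assms that \<open>a > 0\<close> by (intro powr_mono') auto
      finally show ?thesis using assms \<open>a > 0\<close> by (simp add: mult_left_mono)
    qed
    then show "(if d \<le> b * q ^ k then (q ^ k) powr (- \<sigma>) else 0)
        \<le> a powr (- \<sigma>) * (if a \<le> q ^ k then a / q ^ k else 0)"
      by (simp add: iff)
  qed
  also have "\<dots> \<le> a powr (- \<sigma>) * (1 / (1 - q))"
    unfolding sum_distrib_left[symmetric]
    using assms \<open>a > 0\<close> by (intro mult_left_mono sum_truncated_geometric_le) auto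
  also have "\<dots> = b powr \<sigma> / (1 - q) * d powr (- \<sigma>)"
    using assms by (simp add: a_def powr_divide powr_minus field_simps)
  finally show "(\<Sum>k<m. ennreal (if d \<le> b * q ^ k then (q ^ k) powr (- \<sigma>) else 0))
      \<le> ennreal (b powr \<sigma> / (1 - q) * d powr (- \<sigma>))"
    by (subst sum_ennreal) (auto intro: ennreal_leI)
qed

section \<open>Local oscillation is controlled by h\<close>

text \<open>By Jensen's inequality the mean oscillation is at most the \<open>p\<close>-mean.  On \<open>B\<close> one has
  \<open>1 \<le> R powr (n + s p) / norm (w - x) powr (n + s p)\<close> for \<open>w \<noteq> x\<close>, so inserting this weight bounds the \<open>p\<close>-mean
  by the integral that defines \<open>h\<close>, as \<open>B\<close> lies in the ball of radius \<open>d(x) / 2\<close> about \<open>x\<close>.  Taking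
  the \<open>p\<close>-th root splits the constant into \<open>R powr s\<close> and a root of a volume ratio.\<close>

lemma mean_oscillation_le_hfun:
  fixes f :: "'a::euclidean_space \<Rightarrow> real"
  assumes x: "x \<in> \<Omega>" and B: "compact B" "measure lborel B > 0" "continuous_on B f"
    and R: "\<And>w. w \<in> B \<Longrightarrow> norm (w - x) \<le> R" "0 < R" "R \<le> bdist \<Omega> x / 2"
    and "1 \<le> p" "0 < s"
  shows "ennreal (mean B (\<lambda>w. \<bar>f w - f x\<bar>))
      \<le> ennreal (R powr s * (R ^ DIM('a) / measure lborel B) powr (1 / p)) * hfun \<Omega> s p f x"
proof -
  define e where "e = real DIM('a) + s * p"
  define V where "V = measure lborel B"
  define u where "u w = \<bar>f w - f x\<bar>" for w
  define I where "I = (\<integral>\<^sup>+ w \<in> {w. norm (x - w) \<le> bdist \<Omega> x / 2}.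
             ennreal (u w powr p / norm (w - x) powr e) \<partial>lborel)"
  define k where "k = R powr s * (R ^ DIM('a) / V) powr (1 / p)"
  have "V > 0" "e > 0" using B assms by (auto simp: V_def e_def add_pos_pos)
  then have "k > 0" using R by (simp add: k_def)
  have h: "hfun \<Omega> s p f x = ennreal_powr I (1 / p)"
    using x by (simp add: hfun_def I_def u_def e_def)
  have "ennreal (mean B u) \<le> ennreal k * ennreal_powr I (1 / p)"
  proof (cases "I = \<infinity>")
    case True
    then show ?thesis using \<open>k > 0\<close> by (simp add: ennreal_powr_def ennreal_mult_top)
  next
    case False
    have cu: "continuous_on B u" unfolding u_def by (intro continuous_intros B)
    have cp: "continuous_on B (\<lambda>w. u w powr p)"
      using cu \<open>1 \<le> p\<close> by (intro continuous_on_powr') (auto simp: u_def)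
    have "ennreal (V / R powr e * mean B (\<lambda>w. u w powr p))
        = ennreal (mean B (\<lambda>w. V / R powr e * u w powr p))"
      by (simp only: mean_cmult[OF B(1,2)])
    also have "\<dots> = (\<integral>\<^sup>+ w\<in>B. ennreal (V / R powr e * u w powr p / V) \<partial>lborel)"
      unfolding V_def using B(2)
      by (intro ennreal_mean_eq[OF B(1,2)] continuous_on_mult[OF continuous_on_const cp]) auto
    also have "\<dots> \<le> I"
      unfolding I_def
    proof (intro nn_integral_mono)
      fix w
      have "u w powr p / R powr e \<le> u w powr p / norm (w - x) powr e" if "w \<in> B"
      proof (cases "w = x")
        case False
        then show ?thesis using R(1)[OF that] \<open>e > 0\<close> R(2)
          by (intro divide_left_mono powr_mono2) auto
      qed (simp add: u_def)
      moreover have "norm (x - w) \<le> bdist \<Omega> x / 2" if "w \<in> B"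
        using R that by (metis norm_minus_commute order_trans)
      ultimately show "ennreal (V / R powr e * u w powr p / V) * indicator B w
          \<le> ennreal (u w powr p / norm (w - x) powr e) *
             indicator {w. norm (x - w) \<le> bdist \<Omega> x / 2} w"
        using \<open>V > 0\<close> by (auto simp: indicator_def intro!: ennreal_leI)
    qed
    finally have "ennreal (V / R powr e * mean B (\<lambda>w. u w powr p)) \<le> ennreal (enn2real I)"
      using False by (simp add: less_top)
    then have "V / R powr e * mean B (\<lambda>w. u w powr p) \<le> enn2real I"
      by (simp add: ennreal_le_iff)
    then have le: "mean B (\<lambda>w. u w powr p) \<le> R powr e / V * enn2real I"
      using \<open>V > 0\<close> R(2) by (simp add: field_simps)
    have nn: "mean B u \<ge> 0"
      using mean_mono[OF B(1,2) continuous_on_const cu, of 0] mean_const[OF B(1,2), of 0]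
      by (simp add: u_def)
    have "mean B u = (mean B u powr p) powr (1 / p)"
      using nn \<open>1 \<le> p\<close> by (simp add: powr_powr)
    also have "\<dots> \<le> (R powr e / V * enn2real I) powr (1 / p)"
      using mean_powr_le[OF B(1,2) cu _ \<open>1 \<le> p\<close>] le \<open>1 \<le> p\<close>
      by (intro powr_mono2) (auto simp: u_def)
    also have "R powr e = (R powr s) powr p * R ^ DIM('a)"
      using R(2) by (simp add: e_def powr_add powr_powr powr_realpow)
    also have "((R powr s) powr p * R ^ DIM('a) / V * enn2real I) powr (1 / p)
        = ((R powr s) powr p) powr (1 / p) * (R ^ DIM('a) / V) powr (1 / p) * enn2real I powr (1 / p)"
      using R(2) \<open>V > 0\<close> by (simp flip: powr_mult)
    also have "((R powr s) powr p) powr (1 / p) = R powr s"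
      using \<open>1 \<le> p\<close> by (simp add: powr_powr)
    finally have "mean B u \<le> k * enn2real I powr (1 / p)"
      by (simp add: k_def)
    then show ?thesis
      using False \<open>k > 0\<close> by (simp add: ennreal_powr_def ennreal_leI flip: ennreal_mult')
  qed
  then show ?thesis by (simp add: h u_def[abs_def] k_def V_def)
qed

text \<open>The mean may be taken over a ball that does not contain \<open>x\<close>, provided that its radius is comparable with
  its reach \<open>R\<close> from \<open>x\<close>.  The volume ratio of the previous estimate is then at most
  \<open>L ^ n / \<omega>\<close>; replacing it by its maximum with 1 absorbs the root \<open>1 / p\<close> and makes the constant independent
  of \<open>p\<close>.\<close>

lemma deviation_from_mean_le_hfun:
  fixes f :: "'a::euclidean_space \<Rightarrow> real"
  assumes x: "x \<in> \<Omega>" and r: "0 < r" "dist x z + r \<le> R" "R \<le> bdist \<Omega> x / 2" "R \<le> L * r"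
    and f: "continuous_on (cball z r) f" and "1 \<le> p" "0 < s"
  shows "ennreal \<bar>f x - mean (cball z r) f\<bar>
      \<le> ennreal (max 1 (L ^ DIM('a) / unit_ball_vol (real DIM('a))) * R powr s) * hfun \<Omega> s p f x"
proof -
  define n where "n = DIM('a)"
  define \<omega> where "\<omega> = unit_ball_vol (real n)"
  have "\<omega> > 0" by (simp add: \<omega>_def)
  have V: "measure lborel (cball z r) = \<omega> * r ^ n"
    using r by (simp add: content_cball \<omega>_def n_def)
  have B: "compact (cball z r)" "measure lborel (cball z r) > 0"
    using V \<open>\<omega> > 0\<close> r by auto
  have "0 < R" using r zero_le_dist[of x z] by linarith
  have "\<bar>f x - mean (cball z r) f\<bar> = \<bar>mean (cball z r) (\<lambda>w. f w - f x)\<bar>"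
    by (simp add: mean_diff_const[OF B f] abs_minus_commute)
  also have "\<dots> \<le> mean (cball z r) (\<lambda>w. \<bar>f w - f x\<bar>)"
    by (intro abs_mean_le B continuous_intros f)
  finally have "ennreal \<bar>f x - mean (cball z r) f\<bar> \<le> ennreal (mean (cball z r) (\<lambda>w. \<bar>f w - f x\<bar>))"
    by (rule ennreal_leI)
  also have "\<dots> \<le> ennreal (R powr s * (R ^ DIM('a) / measure lborel (cball z r)) powr (1 / p)) * hfun \<Omega> s p f x"
  proof (rule mean_oscillation_le_hfun[OF x B f])
    show "norm (w - x) \<le> R" if "w \<in> cball z r" for w
      using that r(2) dist_triangle[of w x z] by (simp add: dist_norm[symmetric] dist_commute)
  qed (use \<open>0 < R\<close> r assms in auto)
  also have "\<dots> \<le> ennreal (max 1 (L ^ n / \<omega>) * R powr s) * hfun \<Omega> s p f x"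
  proof (intro mult_right_mono ennreal_leI)
    have "R ^ n / (\<omega> * r ^ n) \<le> (L * r) ^ n / (\<omega> * r ^ n)"
      using r \<open>\<omega> > 0\<close> \<open>0 < R\<close> by (intro divide_right_mono power_mono) auto
    also have "\<dots> = L ^ n / \<omega>" using r by (simp add: power_mult_distrib)
    finally have "(R ^ n / (\<omega> * r ^ n)) powr (1 / p) \<le> max 1 (L ^ n / \<omega>) powr (1 / p)"
      using r \<open>\<omega> > 0\<close> \<open>0 < R\<close> \<open>1 \<le> p\<close> by (intro powr_mono2) auto
    also have "\<dots> \<le> max 1 (L ^ n / \<omega>) powr 1"
      using \<open>1 \<le> p\<close> by (intro powr_mono) auto
    finally show "R powr s * (R ^ DIM('a) / measure lborel (cball z r)) powr (1 / p)
        \<le> max 1 (L ^ n / \<omega>) * R powr s"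
      unfolding V n_def[symmetric] by (simp add: mult.commute mult_left_mono)
  qed auto
  finally show ?thesis by (simp add: n_def \<omega>_def)
qed

section \<open>Averages along a chain of balls\<close>

text \<open>The balls are \<open>B k = cball (g (q ^ k)) (c * q ^ k)\<close>.  The constants fit together as follows.  The ratio \<open>q\<close>
  is so close to 1 that consecutive centres are at distance at most \<open>K (1 - q) q ^ k \<le> c q ^ k\<close>; hence all
  points of \<open>B (k + 1)\<close> are within \<open>3 c q ^ k\<close> of any \<open>x\<close> in \<open>B k\<close>.  The factor 7 leaves
  \<open>d(x) \<ge> 6 c q ^ k\<close> on \<open>B k\<close>, so that \<open>3 c q ^ k \<le> d(x) / 2\<close> and \<open>h(x)\<close> controls the deviation of
  \<open>f x\<close> from the mean over \<open>B (k + 1)\<close>.  Finally \<open>\<bar>x - y\<bar> \<le> (K + c) q ^ k\<close> on \<open>B k\<close>, which both yields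
  \<open>\<bar>x - y\<bar> \<le> (K + c) / (6 c) * d(x)\<close> and, for fixed \<open>x\<close>, restricts the sum over \<open>k\<close> to scales not much
  smaller than \<open>\<bar>x - y\<bar>\<close>.  The maxima with 1 in the constant bound powers with exponents
  depending on \<open>s\<close> and \<open>p\<close> uniformly in these exponents.\<close>

lemma chain_of_balls_estimate:
  fixes f :: "'a::euclidean_space \<Rightarrow> real" and g :: "real \<Rightarrow> 'a"
  assumes dim: "DIM('a) \<ge> 2" and "open \<Omega>" and f: "continuous_on \<Omega> f"
    and "0 < s" "s < 1" "1 \<le> p" "0 < c" "0 < K"
    and curve: "\<And>t. 0 \<le> t \<Longrightarrow> t \<le> 1 \<Longrightarrow> g t \<in> \<Omega>"
    and Lip: "\<And>t u. 0 \<le> t \<Longrightarrow> t \<le> u \<Longrightarrow> u \<le> 1 \<Longrightarrow> norm (g u - g t) \<le> K * (u - t)"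
    and away: "\<And>t. 0 \<le> t \<Longrightarrow> t \<le> 1 \<Longrightarrow> 7 * c * t \<le> bdist \<Omega> (g t)"
  defines "q \<equiv> K / (K + c)"
  defines "M \<equiv> max 1 ((3 / q) ^ DIM('a) / unit_ball_vol (real DIM('a)))"
  defines "A \<equiv> M * max 1 (3 * c) / (unit_ball_vol (real DIM('a)) * c ^ DIM('a))"
  shows "ennreal \<bar>f (g 0) - mean (cball (g 1) c) f\<bar>
      \<le> ennreal (A * (max 1 (K + c) ^ DIM('a) / (1 - q))) *
          (\<integral>\<^sup>+ x \<in> {x \<in> \<Omega>. norm (g 0 - x) \<le> (K + c) / (6 * c) * bdist \<Omega> x}.
             hfun \<Omega> s p f x / ennreal (norm (x - g 0) powr (real DIM('a) - s)) \<partial>lborel)"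
proof -
  define n where "n = DIM('a)"
  define \<omega> where "\<omega> = unit_ball_vol (real n)"
  define \<sigma> where "\<sigma> = real n - s"
  define y where "y = g 0"
  define t where "t k = q ^ k" for k
  define B where "B k = cball (g (t k)) (c * t k)" for k
  define a where "a k = mean (B k) f" for k
  define V where "V k = measure lborel (B k)" for k
  define h where "h = hfun \<Omega> s p f"
  define H where "H x = h x / ennreal (norm (x - y) powr \<sigma>) *
      indicator {x \<in> \<Omega>. norm (y - x) \<le> (K + c) / (6 * c) * bdist \<Omega> x} x" for x
  define G where "G k x = ennreal (\<bar>f x - a (Suc k)\<bar> / V k) * indicator (B k) x" for k x
  define C where "C = A * (max 1 (K + c) ^ n / (1 - q))"
  note pos = \<open>0 < c\<close> \<open>0 < K\<close>
  have q: "0 < q" "q < 1" "K * (1 - q) \<le> c"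
    using pos by (auto simp: q_def field_simps)
  have "\<omega> > 0" by (simp add: \<omega>_def)
  have "1 \<le> \<sigma>" using dim \<open>s < 1\<close> by (simp add: \<sigma>_def n_def)
  have "1 \<le> M" by (simp add: M_def)
  have "A > 0" using \<open>1 \<le> M\<close> pos by (simp add: A_def)
  have "C > 0" using \<open>A > 0\<close> q by (simp add: C_def)
  have t: "0 < t k" "t k \<le> 1" "t (Suc k) = q * t k" "t (Suc k) \<le> t k" for k
    using q by (auto simp: t_def power_le_one mult_le_one mult_left_le_one_le)
  have V: "V k = \<omega> * (c * t k) ^ n" for k
    using pos t(1)[of k] by (simp add: V_def B_def content_cball \<omega>_def n_def)
  have V_pos: "V k > 0" for k using V \<open>\<omega> > 0\<close> pos t(1) by simp
  have B: "compact (B k)" "measure lborel (B k) > 0" for k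
    using V_pos by (simp_all add: B_def V_def)
  have ball: "x \<in> \<Omega> \<and> 6 * c * t k \<le> bdist \<Omega> x \<and> norm (x - y) \<le> (K + c) * t k \<and>
              dist x (g (t (Suc k))) + c * t (Suc k) \<le> 3 * c * t k" if "x \<in> B k" for x k
  proof -
    have d: "dist (g (t k)) x \<le> c * t k" using that by (simp add: B_def)
    have far: "7 * c * t k \<le> bdist \<Omega> (g (t k))" using away t[of k] by (simp add: less_imp_le)
    have "x \<in> ball (g (t k)) (bdist \<Omega> (g (t k)))"
      using d far mult_pos_pos[OF \<open>0 < c\<close> t(1)[of k]] by simp
    then have "x \<in> \<Omega>"
      using ball_bdist_subset[of "g (t k)" \<Omega>] curve t[of k] by (auto simp: less_imp_le)
    moreover have "6 * c * t k \<le> bdist \<Omega> x"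
      using far d bdist_triangle[of \<Omega> "g (t k)" x] by simp
    moreover have "norm (x - y) \<le> (K + c) * t k"
    proof -
      have "dist (g (t k)) y \<le> K * t k"
        using Lip[of 0 "t k"] t[of k] by (simp add: y_def dist_norm less_imp_le)
      then show ?thesis
        using d dist_triangle[of x y "g (t k)"] by (simp add: dist_norm[symmetric] dist_commute algebra_simps)
    qed
    moreover have "dist x (g (t (Suc k))) + c * t (Suc k) \<le> 3 * c * t k"
    proof -
      have "dist (g (t k)) (g (t (Suc k))) \<le> K * (t k - t (Suc k))"
        using Lip[OF less_imp_le[OF t(1)] t(4) t(2)] by (simp add: dist_norm)
      also have "\<dots> = K * (1 - q) * t k" by (simp add: t(3) algebra_simps)
      also have "\<dots> \<le> c * t k" using q(3) t(1)[of k] by (intro mult_right_mono) auto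
      finally have "dist (g (t k)) (g (t (Suc k))) \<le> c * t k" .
      moreover have "c * t (Suc k) \<le> c * t k" using t(4) pos by simp
      ultimately show ?thesis
        using d dist_triangle[of x "g (t (Suc k))" "g (t k)"] by (simp add: dist_commute)
    qed
    ultimately show ?thesis by blast
  qed
  have B_sub: "B k \<subseteq> \<Omega>" for k using ball by blast
  have f_B: "continuous_on (B k) f" for k
    using f B_sub continuous_on_subset by blast
  have t_lim: "t \<longlonglongrightarrow> 0" unfolding t_def using q by (intro LIMSEQ_realpow_zero) auto
  have G_meas [measurable]: "G k \<in> borel_measurable lborel" for k
  proof -
    have "integrable lborel (\<lambda>x. indicator (B k) x *\<^sub>R (\<bar>f x - a (Suc k)\<bar> / V k))"
      using V_pos[of k] by (intro borel_integrable_compact B continuous_intros f_B) auto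
    then have "(\<lambda>x. ennreal (indicator (B k) x *\<^sub>R (\<bar>f x - a (Suc k)\<bar> / V k))) \<in> borel_measurable lborel"
      by measurable
    also have "(\<lambda>x. ennreal (indicator (B k) x *\<^sub>R (\<bar>f x - a (Suc k)\<bar> / V k))) = G k"
      by (auto simp: G_def fun_eq_iff indicator_def)
    finally show "G k \<in> borel_measurable lborel" .
  qed
  have "(\<lambda>k. g (t k)) \<longlonglongrightarrow> y"
  proof (rule metric_tendsto_imp_tendsto)
    show "(\<lambda>k. K * t k) \<longlonglongrightarrow> 0" using tendsto_mult_right_zero[OF t_lim] .
    show "\<forall>\<^sub>F k in sequentially. dist (g (t k)) y \<le> dist (K * t k) 0"
      using Lip[of 0 "t _"] t pos less_imp_le[OF t(1)] by (simp add: y_def dist_norm abs_mult)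
  qed
  then have "a \<longlonglongrightarrow> f y"
    unfolding a_def B_def
    using curve[of 0] f \<open>open \<Omega>\<close> t(1) pos B_sub tendsto_mult_right_zero[OF t_lim]
    by (intro mean_cball_tendsto[where \<Omega> = \<Omega>]) (auto simp: y_def B_def)
  then have "ennreal \<bar>f y - a 0\<bar> \<le> (\<Sum>k. ennreal \<bar>a k - a (Suc k)\<bar>)"
    by (rule abs_diff_limit_le_suminf)
  also have "\<dots> \<le> (\<Sum>k. \<integral>\<^sup>+ x. G k x \<partial>lborel)"
  proof (intro suminf_le summableI)
    fix k
    have "ennreal \<bar>a k - a (Suc k)\<bar> \<le> ennreal (mean (B k) (\<lambda>x. \<bar>f x - a (Suc k)\<bar>))"
      using abs_mean_le[OF B continuous_on_diff[OF f_B continuous_on_const], of k "a (Suc k)"]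
      by (simp add: mean_diff_const[OF B f_B] a_def[of k] ennreal_leI)
    also have "\<dots> = (\<integral>\<^sup>+ x. G k x \<partial>lborel)"
      unfolding G_def V_def using f_B by (intro ennreal_mean_eq[OF B]) (auto intro!: continuous_intros)
    finally show "ennreal \<bar>a k - a (Suc k)\<bar> \<le> (\<integral>\<^sup>+ x. G k x \<partial>lborel)" .
  qed
  also have "\<dots> = (\<integral>\<^sup>+ x. (\<Sum>k. G k x) \<partial>lborel)"
    by (rule nn_integral_suminf[symmetric]) (rule G_meas)
  finally have repr: "ennreal \<bar>f y - a 0\<bar> \<le> (\<integral>\<^sup>+ x. (\<Sum>k. G k x) \<partial>lborel)" .
  \<comment> \<open>The radius and the volume of \<open>B k\<close> combine into \<open>q ^ k\<close> to the power \<open>s - n = - \<sigma>\<close>.\<close>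
  have G_le: "G k x \<le> ennreal A * (ennreal (if norm (x - y) \<le> (K + c) * q ^ k then (q ^ k) powr (- \<sigma>) else 0)) * h x"
    for k x
  proof (cases "x \<in> B k")
    case True
    note x = ball[OF True]
    have "ennreal \<bar>f x - a (Suc k)\<bar> \<le> ennreal (M * (3 * c * t k) powr s) * h x"
      unfolding a_def B_def M_def h_def
      using x pos t(1) q f_B[of "Suc k", unfolded B_def] \<open>1 \<le> p\<close> \<open>0 < s\<close>
      by (intro deviation_from_mean_le_hfun) (auto simp: t(3))
    then have "ennreal (1 / V k) * ennreal \<bar>f x - a (Suc k)\<bar>
        \<le> ennreal (1 / V k) * (ennreal (M * (3 * c * t k) powr s) * h x)"
      by (rule mult_left_mono) auto
    also have "ennreal (1 / V k) * ennreal \<bar>f x - a (Suc k)\<bar> = G k x"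
      using True V_pos[of k] by (simp add: G_def flip: ennreal_mult')
    also have "ennreal (1 / V k) * (ennreal (M * (3 * c * t k) powr s) * h x)
        = ennreal (1 / V k) * ennreal (M * (3 * c * t k) powr s) * h x"
      by (rule mult.assoc[symmetric])
    also have "\<dots> = ennreal (1 / V k * (M * (3 * c * t k) powr s)) * h x"
      using V_pos[of k] \<open>1 \<le> M\<close> by (subst ennreal_mult[symmetric]) auto
    also have "\<dots> \<le> ennreal (A * t k powr (- \<sigma>)) * h x"
    proof (intro mult_right_mono ennreal_leI)
      have "1 / V k * (M * (3 * c * t k) powr s) = M * (3 * c) powr s / (\<omega> * c ^ n) * (t k powr s / t k ^ n)"
        using pos t(1)[of k] by (simp add: V powr_mult power_mult_distrib)
      also have "t k powr s / t k ^ n = t k powr (- \<sigma>)"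
        using t(1)[of k] by (simp add: \<sigma>_def powr_diff powr_realpow)
      also have "(3 * c) powr s \<le> max 1 (3 * c) powr s"
        using pos \<open>0 < s\<close> by (intro powr_mono2) auto
      also have "max 1 (3 * c) powr s \<le> max 1 (3 * c) powr 1"
        using \<open>s < 1\<close> by (intro powr_mono) auto
      finally show "1 / V k * (M * (3 * c * t k) powr s) \<le> A * t k powr (- \<sigma>)"
        using \<open>1 \<le> M\<close> \<open>\<omega> > 0\<close> pos
        by (simp add: A_def \<omega>_def n_def mult_left_mono mult_right_mono divide_right_mono)
    qed auto
    finally show ?thesis
      using x \<open>A > 0\<close> by (simp add: t_def ennreal_mult')
  qed (simp add: G_def)
  have sum_le: "(\<Sum>k. G k x) \<le> ennreal C * H x" if "x \<noteq> y" for x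
  proof (cases "\<exists>k. x \<in> B k")
    case False
    then show ?thesis by (simp add: G_def)
  next
    case True
    then obtain k where "x \<in> B k" by blast
    note x = ball[OF this]
    have "norm (y - x) \<le> (K + c) / (6 * c) * (6 * c * t k)"
      using x pos by (simp add: norm_minus_commute)
    also have "\<dots> \<le> (K + c) / (6 * c) * bdist \<Omega> x"
      using x pos by (intro mult_left_mono) auto
    finally have H: "H x = h x / ennreal (norm (x - y) powr \<sigma>)"
      using x by (simp add: H_def)
    have "(\<Sum>k. G k x) \<le> (\<Sum>k. ennreal A * ennreal (if norm (x - y) \<le> (K + c) * q ^ k then (q ^ k) powr (- \<sigma>) else 0) * h x)"
      by (intro suminf_le summableI G_le)
    also have "\<dots> = ennreal A * (\<Sum>k. ennreal (if norm (x - y) \<le> (K + c) * q ^ k then (q ^ k) powr (- \<sigma>) else 0)) * h x"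
      by simp
    also have "\<dots> \<le> ennreal A * ennreal ((K + c) powr \<sigma> / (1 - q) * norm (x - y) powr (- \<sigma>)) * h x"
      using q pos that \<open>1 \<le> \<sigma>\<close> by (intro mult_right_mono mult_left_mono suminf_scales_le) auto
    also have "\<dots> \<le> ennreal A * ennreal (max 1 (K + c) ^ n / (1 - q) * norm (x - y) powr (- \<sigma>)) * h x"
    proof (intro mult_right_mono mult_left_mono ennreal_leI divide_right_mono)
      have "(K + c) powr \<sigma> \<le> max 1 (K + c) powr \<sigma>"
        using pos \<open>1 \<le> \<sigma>\<close> by (intro powr_mono2) auto
      also have "\<dots> \<le> max 1 (K + c) powr real n"
        using \<open>0 < s\<close> by (intro powr_mono) (auto simp: \<sigma>_def)
      finally show "(K + c) powr \<sigma> \<le> max 1 (K + c) ^ n" by (simp add: powr_realpow)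
    qed (use q in auto)
    also have "\<dots> = ennreal C * (h x * ennreal (norm (x - y) powr (- \<sigma>)))"
    proof -
      have "ennreal A * ennreal (max 1 (K + c) ^ n / (1 - q) * norm (x - y) powr (- \<sigma>))
          = ennreal (C * norm (x - y) powr (- \<sigma>))"
        using \<open>A > 0\<close> by (simp add: C_def mult.assoc flip: ennreal_mult')
      also have "\<dots> = ennreal C * ennreal (norm (x - y) powr (- \<sigma>))"
        using \<open>C > 0\<close> by (intro ennreal_mult) auto
      finally show ?thesis by (simp add: ac_simps)
    qed
    also have "h x * ennreal (norm (x - y) powr (- \<sigma>)) = H x"
      using that by (simp add: H divide_ennreal_def inverse_ennreal powr_minus)
    finally show ?thesis .
  qed
  have "ennreal \<bar>f y - a 0\<bar> \<le> (\<integral>\<^sup>+ x. (\<Sum>k. G k x) \<partial>lborel)"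
    by (rule repr)
  \<comment> \<open>The constant is taken out of the integral of the measurable function \<open>\<Sum>k. G k x\<close>; the function \<open>H\<close>
    then enters through monotonicity only.  The point \<open>x = y\<close>, at which \<open>H\<close> has a junk value, is
    discarded as a null set.\<close>
  also have "\<dots> = (\<integral>\<^sup>+ x. ennreal C * (ennreal (1 / C) * (\<Sum>k. G k x)) \<partial>lborel)"
    using \<open>C > 0\<close> by (simp add: mult.assoc[symmetric] ennreal_mult'[symmetric])
  also have "\<dots> = ennreal C * (\<integral>\<^sup>+ x. ennreal (1 / C) * (\<Sum>k. G k x) \<partial>lborel)"
    by (intro nn_integral_cmult) measurable
  also have "\<dots> \<le> ennreal C * (\<integral>\<^sup>+ x. H x \<partial>lborel)"
  proof (intro mult_left_mono nn_integral_mono_AE)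
    have "AE x in lborel. x \<noteq> y" by (rule AE_lborel_singleton)
    then show "AE x in lborel. ennreal (1 / C) * (\<Sum>k. G k x) \<le> H x"
    proof eventually_elim
      case (elim x)
      have "ennreal (1 / C) * (\<Sum>k. G k x) \<le> ennreal (1 / C) * (ennreal C * H x)"
        by (intro mult_left_mono sum_le elim) auto
      also have "\<dots> = H x"
        using \<open>C > 0\<close> by (simp add: mult.assoc[symmetric] ennreal_mult'[symmetric])
      finally show ?case .
    qed
  qed auto
  finally show ?thesis
    by (simp add: C_def H_def h_def y_def a_def B_def t_def n_def \<sigma>_def)
qed

theorem proposition3p1:
  fixes \<Omega> :: "(real ^ 'n) set"
  assumes "CARD('n) \<ge> 2" and "John_domain \<Omega>"
  shows "\<exists>C>0. \<exists>C\<^sub>1>0. \<forall>s p :: real. \<forall>f :: real ^ 'n \<Rightarrow> real.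
           0 < s \<and> s < 1 \<and> 1 \<le> p \<and> Cinf_on f \<Omega> \<longrightarrow>
           (\<exists>fbar :: real. \<forall>y\<in>\<Omega>.
              ennreal \<bar>f y - fbar\<bar> \<le>
                ennreal C * (\<integral>\<^sup>+ x \<in> {x \<in> \<Omega>. norm (y - x) \<le> C\<^sub>1 * bdist \<Omega> x}.
                   hfun \<Omega> s p f x / ennreal (norm (x - y) powr (real CARD('n) - s)) \<partial>lborel))"
proof -
  have "open \<Omega>" using assms(2) by (simp add: John_domain_def)
  obtain \<gamma> :: "real ^ 'n \<Rightarrow> real \<Rightarrow> real ^ 'n" and \<kappa> K where "\<kappa> > 0" "K > 0"
    and curve: "\<And>y. y \<in> \<Omega> \<Longrightarrow> abs_continuous_curve (\<gamma> y) \<and> \<gamma> y ` {0..1} \<subseteq> \<Omega> \<and>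
           \<gamma> y 0 = y \<and> \<gamma> y 1 = 0 \<and>
           (\<forall>t\<in>{0..1}. bdist \<Omega> (\<gamma> y t) \<ge> \<kappa> * t) \<and>
           (AE t in lborel. t \<in> {0..1} \<longrightarrow>
              (\<exists>v. (\<gamma> y has_vector_derivative v) (at t within {0..1}) \<and> norm v \<le> K))"
    using assms(2) unfolding John_domain_def
    by (elim conjE exE) (rule that, assumption, assumption, drule (1) bspec, elim conjE, intro conjI; assumption)
  \<comment> \<open>The mean over the ball of radius \<open>c\<close> about the end point 0 of all curves serves every \<open>y\<close> at once.\<close>
  define c where "c = \<kappa> / 7"
  have "c > 0" using \<open>\<kappa> > 0\<close> by (simp add: c_def)
  define N where "N = DIM(real ^ 'n)"
  define q where "q = K / (K + c)"
  define A where "A = max 1 ((3 / q) ^ N / unit_ball_vol (real N)) * max 1 (3 * c) / (unit_ball_vol (real N) * c ^ N)"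
  define C where "C = A * (max 1 (K + c) ^ N / (1 - q))"
  define C\<^sub>1 where "C\<^sub>1 = (K + c) / (6 * c)"
  have "q < 1" using \<open>K > 0\<close> \<open>c > 0\<close> by (simp add: q_def)
  have "A > 0" using \<open>c > 0\<close> by (auto simp: A_def intro!: divide_pos_pos mult_pos_pos)
  then have "C > 0" using \<open>q < 1\<close> by (auto simp: C_def intro!: divide_pos_pos mult_pos_pos)
  have "C\<^sub>1 > 0" using \<open>K > 0\<close> \<open>c > 0\<close> by (simp add: C\<^sub>1_def)
  have main: "ennreal \<bar>f y - mean (cball 0 c) f\<bar> \<le>
      ennreal C * (\<integral>\<^sup>+ x \<in> {x \<in> \<Omega>. norm (y - x) \<le> C\<^sub>1 * bdist \<Omega> x}.
         hfun \<Omega> s p f x / ennreal (norm (x - y) powr (real CARD('n) - s)) \<partial>lborel)"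
    if "0 < s" "s < 1" "1 \<le> p" "Cinf_on f \<Omega>" "y \<in> \<Omega>" for s p and f :: "real ^ 'n \<Rightarrow> real" and y
  proof -
    note \<gamma> = curve[OF \<open>y \<in> \<Omega>\<close>]
    have "continuous_on \<Omega> f"
      using \<open>Cinf_on f \<Omega>\<close> unfolding Cinf_on_def by (metis Ck_on.simps(1))
    moreover have "norm (\<gamma> y u - \<gamma> y t) \<le> K * (u - t)" if "0 \<le> t" "t \<le> u" "u \<le> 1" for t u
      using \<gamma> \<open>K > 0\<close> that by (intro abs_continuous_curve_Lipschitz) auto
    ultimately have "ennreal \<bar>f (\<gamma> y 0) - mean (cball (\<gamma> y 1) c) f\<bar>
      \<le> ennreal C * (\<integral>\<^sup>+ x \<in> {x \<in> \<Omega>. norm (\<gamma> y 0 - x) \<le> C\<^sub>1 * bdist \<Omega> x}.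
             hfun \<Omega> s p f x / ennreal (norm (x - \<gamma> y 0) powr (real DIM(real ^ 'n) - s)) \<partial>lborel)"
      unfolding C_def C\<^sub>1_def A_def q_def N_def
      using \<gamma> that assms(1) \<open>open \<Omega>\<close> \<open>c > 0\<close> \<open>K > 0\<close>
      by (intro chain_of_balls_estimate) (auto simp: c_def)
    then show ?thesis using \<gamma> by simp
  qed
  show ?thesis
    using main \<open>C > 0\<close> \<open>C\<^sub>1 > 0\<close> by blast
qed

end
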